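(* Let $\mathbb{D}=\{z\in\mathbb{C}:|z|<1\}$ and $z_1,z_2\in\mathbb{D}$. Then $$s_{\mathbb{D}}(z_1,z_2)=\frac{|z_1-z_2|}{|z_1-u|+|z_2-u|},$$ where $u\in\partial\mathbb{D}$ is a minimizing root of the equation $$\overline{z_1}\,\overline{z_2}\,u^4-(\overline{z_1}+\overline{z_2})u^3+(z_1+z_2)u-z_1z_2=0.$$
   Context: The triangular ratio metric of the unit disk is defined for $z_1,z_2\in\mathbb{D}$ by $$s_{\mathbb{D}}(z_1,z_2)=\sup_{z\in\partial\mathbb{D}}\frac{|z_1-z_2|}{|z_1-z|+|z-z_2|}.$$ A minimizing root of the displayed equation is a root $u$ with $|u|=1$ which minimizes the sum $|z_1-u|+|z_2-u|$ among all roots of the equation lying on the unit circle $\partial\mathbb{D}$. A minimizing root need not be unique. *)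

theory Defs
  imports "HOL-Analysis.Analysis"
begin

text \<open>
  For points of the open unit disk the supremum below is the supremum of a nonempty, bounded
  above set of reals: the denominator is bounded below by a positive constant on the unit circle.
  Hence the \<open>SUP\<close> of the conditionally complete order on \<^typ>\<open>real\<close> is the
  genuine supremum. The definition is only meaningful for such points.
\<close>

definition triangular_ratio_disk :: "complex \<Rightarrow> complex \<Rightarrow> real" where
  "triangular_ratio_disk z1 z2 =
     (SUP z\<in>frontier (ball 0 1). cmod (z1 - z2) / (cmod (z1 - z) + cmod (z - z2)))"

definition quartic_root :: "complex \<Rightarrow> complex \<Rightarrow> complex \<Rightarrow> bool" where
  "quartic_root z1 z2 u \<longleftrightarrow>
     cnj z1 * cnj z2 * u ^ 4 - (cnj z1 + cnj z2) * u ^ 3 + (z1 + z2) * u - z1 * z2 = 0"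

definition minimizing_root :: "complex \<Rightarrow> complex \<Rightarrow> complex \<Rightarrow> bool" where
  "minimizing_root z1 z2 u \<longleftrightarrow>
     cmod u = 1 \<and> quartic_root z1 z2 u \<and>
     (\<forall>v. cmod v = 1 \<and> quartic_root z1 z2 v \<longrightarrow>
        cmod (z1 - u) + cmod (z2 - u) \<le> cmod (z1 - v) + cmod (z2 - v))"

end

theory Submission
  imports Defs
begin

text \<open>
  The distance sum \<open>|z\<^sub>1 - u| + |z\<^sub>2 - u|\<close> attains its minimum on the unit circle, and the supremum
  is the quotient at any minimum point. On the circle the quartic equals \<open>2\<i>u\<^sup>2\<close> times the imaginary
  part of \<open>pq\<close>, where \<open>p = 1 - cnj z\<^sub>1 u\<close> and \<open>q = 1 - cnj z\<^sub>2 u\<close> satisfy \<open>|p| = |z\<^sub>1 - u|\<close> and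
  \<open>|q| = |z\<^sub>2 - u|\<close>. Stationarity in the angle reads \<open>Im p / |p| + Im q / |q| = 0\<close>; as \<open>p\<close> and \<open>q\<close> have
  positive real parts, \<open>p / |p|\<close> and \<open>q / |q|\<close> are conjugate, so \<open>pq\<close> is real. Hence every minimum
  point on the circle is a root, and the minimizing roots are exactly the minimum points.
\<close>

lemma cmod_diff_eq_cmod_one_minus_cnj_mult:
  assumes "cmod u = 1"
  shows "cmod (z - u) = cmod (1 - cnj z * u)"
proof -
  have "1 - cnj z * u = cnj (u - z) * u"
    using assms by (simp add: algebra_simps complex_norm_square[symmetric])
  also have "cmod \<dots> = cmod (z - u)"
    using assms by (simp only: norm_mult complex_mod_cnj norm_minus_commute mult_1_right)
  finally show ?thesis ..
qed

lemma quartic_root_iff: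
  assumes "cmod u = 1"
  shows "quartic_root z1 z2 u \<longleftrightarrow> Im ((1 - cnj z1 * u) * (1 - cnj z2 * u)) = 0"
proof -
  define w where "w = (1 - cnj z1 * u) * (1 - cnj z2 * u)"
  have u: "u * cnj u = 1"
    using assms by (simp add: complex_norm_square[symmetric])
  \<comment> \<open>Each \<open>cnj u\<close> in \<open>cnj w\<close> cancels one \<open>u\<close>,
    so \<open>u\<^sup>2 * cnj w = (u - z1) * (u - z2)\<close>; the pure \<open>u\<^sup>2\<close>
    terms then drop out.\<close>
  have "cnj z1 * cnj z2 * u ^ 4 - (cnj z1 + cnj z2) * u ^ 3 + (z1 + z2) * u - z1 * z2
      = u\<^sup>2 * (w - cnj w)"
    using u unfolding w_def complex_cnj_mult complex_cnj_diff complex_cnj_cnj complex_cnj_one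
    by algebra
  moreover have "u \<noteq> 0"
    using assms by auto
  moreover have "w - cnj w = 0 \<longleftrightarrow> Im w = 0"
    by (simp add: complex_eq_iff)
  ultimately show ?thesis
    unfolding quartic_root_def w_def[symmetric] by (metis mult_eq_0_iff power_eq_0_iff)
qed

lemma Im_mult_eq_0_if_Im_sgn_add_eq_0:
  assumes "Re p > 0" "Re q > 0" and "Im p / cmod p + Im q / cmod q = 0"
  shows "Im (p * q) = 0"
proof -
  have sgn_unit: "(Re (sgn z))\<^sup>2 + (Im (sgn z))\<^sup>2 = 1" "Re (sgn z) > 0" if "Re z > 0" for z
  proof -
    have "z \<noteq> 0" using that by auto
    then show "(Re (sgn z))\<^sup>2 + (Im (sgn z))\<^sup>2 = 1"
      by (metis cmod_power2 norm_sgn one_power2)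
    show "Re (sgn z) > 0"
      using that \<open>z \<noteq> 0\<close> by simp
  qed
  have Im: "Im (sgn p) = - Im (sgn q)"
    using assms(3) by simp
  then have "(Re (sgn p))\<^sup>2 = (Re (sgn q))\<^sup>2"
    using sgn_unit(1)[OF assms(1)] sgn_unit(1)[OF assms(2)] by simp
  then have "Re (sgn p) = Re (sgn q)"
    using sgn_unit(2)[OF assms(1)] sgn_unit(2)[OF assms(2)] by (simp add: power2_eq_iff)
  then have "Im (sgn (p * q)) = 0"
    using Im by (simp add: sgn_mult del: Re_sgn Im_sgn)
  \<comment> \<open>\<open>p * q\<close> is nonzero, hence a positive multiple of its
    \<open>sgn\<close>.\<close>
  then show ?thesis
    using assms(1,2) by auto
qed

text \<open>The square of the distance is
  \<open>(cmod z)\<^sup>2 + 1 - 2 * Re (cnj z * cis t)\<close>, and differentiating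
  \<open>cis t\<close> multiplies it by \<open>\<i>\<close>, which turns the real part into minus
  the imaginary part.\<close>

lemma has_real_derivative_cmod_diff_cis:
  assumes "z \<noteq> cis t"
  shows "((\<lambda>t. cmod (z - cis t)) has_real_derivative Im (cnj z * cis t) / cmod (z - cis t)) (at t)"
proof -
  have "cmod (z - cis t) > 0"
    using assms by simp
  then have "(Re z - cos t)\<^sup>2 + (Im z - sin t)\<^sup>2 > 0"
    by (simp add: cmod_def)
  moreover have "((\<lambda>t. (Re z - cos t)\<^sup>2 + (Im z - sin t)\<^sup>2)
      has_real_derivative 2 * Im (cnj z * cis t)) (at t)"
    by (auto intro!: derivative_eq_intros simp: algebra_simps)
  ultimately have "((\<lambda>t. sqrt ((Re z - cos t)\<^sup>2 + (Im z - sin t)\<^sup>2)) has_real_derivative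
      inverse (sqrt ((Re z - cos t)\<^sup>2 + (Im z - sin t)\<^sup>2)) / 2 * (2 * Im (cnj z * cis t))) (at t)"
    by (intro DERIV_chain2[OF DERIV_real_sqrt])
  moreover have "inverse s / 2 * (2 * x) = x / s" for s x :: real
    by (simp add: field_simps)
  ultimately show ?thesis
    by (simp only: cmod_def minus_complex.sel cis.sel)
qed

lemma quartic_root_if_minimal:
  assumes z: "cmod z1 < 1" "cmod z2 < 1" and u: "cmod u = 1"
    and min: "\<And>v. cmod v = 1 \<Longrightarrow> cmod (z1 - u) + cmod (z2 - u) \<le> cmod (z1 - v) + cmod (z2 - v)"
  shows "quartic_root z1 z2 u"
proof -
  obtain t where t: "u = cis t"
    using u by (metis cis_Arg norm_zero sgn_div_norm inverse_1 scaleR_one zero_neq_one)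
  have ne: "z1 \<noteq> cis t" "z2 \<noteq> cis t"
    using z by auto
  define D where "D = Im (cnj z1 * u) / cmod (z1 - u) + Im (cnj z2 * u) / cmod (z2 - u)"
  have "((\<lambda>t. cmod (z1 - cis t) + cmod (z2 - cis t)) has_real_derivative D) (at t)"
    unfolding D_def t by (intro DERIV_add has_real_derivative_cmod_diff_cis ne)
  then have D: "D = 0"
    \<comment> \<open>The minimum is global on the circle, so any positive radius \<open>d\<close>
      would do.\<close>
    by (rule DERIV_local_min[where d = 1]) (use min t in auto)
  have pos: "Re (1 - cnj z * u) > 0" if "cmod z < 1" for z
    using complex_Re_le_cmod[of "cnj z * u"] that u by (simp add: norm_mult)
  have "Im (1 - cnj z1 * u) / cmod (1 - cnj z1 * u) + Im (1 - cnj z2 * u) / cmod (1 - cnj z2 * u)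
      = - D"
    unfolding D_def cmod_diff_eq_cmod_one_minus_cnj_mult[OF u] minus_complex.sel one_complex.sel
    by (simp only: diff_0 divide_minus_left minus_add_distrib)
  then show ?thesis
    unfolding quartic_root_iff[OF u]
    by (intro Im_mult_eq_0_if_Im_sgn_add_eq_0 pos z) (simp only: D minus_zero)
qed

text \<open>The numerator is constant, so the quotient is largest where the distance sum is
  smallest, and the supremum is a maximum.\<close>

lemma triangular_ratio_disk_eq_if_minimal:
  assumes z: "cmod z1 < 1" and u: "cmod u = 1"
    and min: "\<And>v. cmod v = 1 \<Longrightarrow> cmod (z1 - u) + cmod (z2 - u) \<le> cmod (z1 - v) + cmod (z2 - v)"
  shows "triangular_ratio_disk z1 z2 = cmod (z1 - z2) / (cmod (z1 - u) + cmod (z2 - u))"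
  unfolding triangular_ratio_disk_def
proof (rule cSup_eq_maximum)
  show "cmod (z1 - z2) / (cmod (z1 - u) + cmod (z2 - u))
      \<in> (\<lambda>z. cmod (z1 - z2) / (cmod (z1 - z) + cmod (z - z2))) ` frontier (ball 0 1)"
    using u by (auto intro!: image_eqI[of _ _ u] simp: norm_minus_commute)
  have "z1 \<noteq> u"
    using z u by auto
  then have "0 < cmod (z1 - u) + cmod (z2 - u)"
    by (simp add: add_pos_nonneg)
  then have "cmod (z1 - z2) / (cmod (z1 - v) + cmod (v - z2))
      \<le> cmod (z1 - z2) / (cmod (z1 - u) + cmod (z2 - u))" if "cmod v = 1" for v
    using min[OF that] by (intro divide_left_mono) (auto simp: norm_minus_commute)
  then show "x \<le> cmod (z1 - z2) / (cmod (z1 - u) + cmod (z2 - u))"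
    if "x \<in> (\<lambda>z. cmod (z1 - z2) / (cmod (z1 - z) + cmod (z - z2))) ` frontier (ball 0 1)" for x
    using that by auto
qed

theorem corollary1p5:
  fixes z1 z2 :: complex
  assumes "z1 \<in> ball 0 1" and "z2 \<in> ball 0 1"
  shows "(\<exists>u. minimizing_root z1 z2 u) \<and>
         (\<forall>u. minimizing_root z1 z2 u \<longrightarrow>
            triangular_ratio_disk z1 z2 =
              cmod (z1 - z2) / (cmod (z1 - u) + cmod (z2 - u)))"
proof -
  have z: "cmod z1 < 1" "cmod z2 < 1"
    using assms by auto
  \<comment> \<open>The circle is compact and the distance sum is continuous.\<close>
  have "\<exists>u\<in>sphere 0 1. \<forall>v\<in>sphere 0 1.
      cmod (z1 - u) + cmod (z2 - u) \<le> cmod (z1 - v) + cmod (z2 - v)"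
    by (intro continuous_attains_inf continuous_intros) auto
  then obtain u where u: "cmod u = 1"
    and min: "\<And>v. cmod v = 1 \<Longrightarrow> cmod (z1 - u) + cmod (z2 - u) \<le> cmod (z1 - v) + cmod (z2 - v)"
    by auto
  have root: "quartic_root z1 z2 u"
    using z u min by (rule quartic_root_if_minimal)
  show ?thesis
  proof (intro conjI exI allI impI)
    show "minimizing_root z1 z2 u"
      using u root min by (simp add: minimizing_root_def)
  next
    fix w assume "minimizing_root z1 z2 w"
    \<comment> \<open>The global minimum point \<open>u\<close> is itself a root, so it competes
      with \<open>w\<close>; thus minimality among roots becomes minimality on the whole
      circle.\<close>
    then have w: "cmod w = 1" and "cmod (z1 - w) + cmod (z2 - w) \<le> cmod (z1 - u) + cmod (z2 - u)"
      using u root by (auto simp: minimizing_root_def)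
    then have "cmod (z1 - w) + cmod (z2 - w) \<le> cmod (z1 - v) + cmod (z2 - v)" if "cmod v = 1" for v
      using min[OF that] by linarith
    with z(1) w show "triangular_ratio_disk z1 z2 = cmod (z1 - z2) / (cmod (z1 - w) + cmod (z2 - w))"
      by (rule triangular_ratio_disk_eq_if_minimal)
  qed
qed

end
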